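(* Suppose that for every $t_0\in T$ the largest singular value $\sigma_{\max}(t)$ of $W(t)$ is simple for all $t\ge t_0$, and that $\|f(t,x)\|\le l(t)\|x\|$ for all $x\in\Omega_1$, $t\ge t_0$. Let $$\chi(t_0)=\limsup_{t\to\infty}\,(t-t_0)^{-1}\Big(\int_{t_0}^t k(s)l(s)\,ds+\ln\|W(t)\|\Big).$$ Assume that $\chi(t_0)<0$ for all $t_0\in T$. Then the trivial solution of $\dot x=A(t)x+f(t,x)$ is asymptotically stable.
   Context: $\|\cdot\|$ is the Euclidean norm on $\mathbb{R}^n$ and the induced spectral norm on matrices. $T=[\varsigma,\infty)$ with $\varsigma\in\mathbb{R}$. Consider $\dot x=A(t)x+f(t,x)$, $x\in\mathbb{R}^n$, $t\ge t_0\in T$, where $A(t)\in\mathbb{R}^{n\times n}$ and $f(t,x)\in\mathbb{R}^n$ are continuous and $f(t,0)=0$. The solution $x(t,x_0)$ with $x(t_0,x_0)=x_0$ is assumed to be uniquely defined for all $t\ge t_0$ whenever $x_0$ lies in a fixed neighborhood of $0$. For given $t_0$, $W(t)$ is a fundamental solution matrix of $\dot x=A(t)x$ normalized so that $\|W(t_0)\|=1$ (so $W$ and $k$ may depend on $t_0$), and $k(t)=\|W(t)\|\,\|W^{-1}(t)\|$. $\Omega_1\subset\mathbb{R}^n$ is a bounded neighborhood of $0$, and $l$ is a continuous function with $0<l(t)\le\hat l<\infty$. *)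

theory Defs
  imports "HOL-Analysis.Analysis"
begin

text \<open>The norm of \<^typ>\<open>real^'n^'m\<close> as a vector type is the Frobenius norm, so the
  matrix norm induced by the Euclidean norm is introduced separately.\<close>

definition spectral_norm :: "real^'n^'m \<Rightarrow> real" where
  "spectral_norm M = onorm (\<lambda>v. M *v v)"

definition cond_number :: "real^'n^'n \<Rightarrow> real" where
  "cond_number M = spectral_norm M * spectral_norm (matrix_inv M)"

text \<open>Since \<open>transpose M ** M\<close> is symmetric, the algebraic multiplicity of an
  eigenvalue is the dimension of its eigenspace.\<close>

definition right_singular_space :: "real^'n^'m \<Rightarrow> real \<Rightarrow> (real^'n) set" where
  "right_singular_space M \<sigma> = {v. (transpose M ** M) *v v = \<sigma>\<^sup>2 *\<^sub>R v}"

definition singular_value :: "real^'n^'m \<Rightarrow> real \<Rightarrow> bool" where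
  "singular_value M \<sigma> \<longleftrightarrow> 0 \<le> \<sigma> \<and> (\<exists>v. v \<noteq> 0 \<and> v \<in> right_singular_space M \<sigma>)"

definition largest_singular_value :: "real^'n^'m \<Rightarrow> real \<Rightarrow> bool" where
  "largest_singular_value M \<sigma> \<longleftrightarrow>
     singular_value M \<sigma> \<and> (\<forall>\<sigma>'. singular_value M \<sigma>' \<longrightarrow> \<sigma>' \<le> \<sigma>)"

definition simple_largest_singular_value :: "real^'n^'m \<Rightarrow> bool" where
  "simple_largest_singular_value M \<longleftrightarrow>
     (\<exists>\<sigma>. largest_singular_value M \<sigma> \<and> dim (right_singular_space M \<sigma>) = 1)"

definition fundamental_matrix ::
  "(real \<Rightarrow> real^'n^'n) \<Rightarrow> real \<Rightarrow> (real \<Rightarrow> real^'n^'n) \<Rightarrow> bool" where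
  "fundamental_matrix A t0 W \<longleftrightarrow>
     (\<forall>t\<ge>t0. (W has_vector_derivative A t ** W t) (at t within {t0..}) \<and> invertible (W t))"

definition ivp_solution ::
  "(real \<Rightarrow> 'a \<Rightarrow> 'a::real_normed_vector) \<Rightarrow> real \<Rightarrow> 'a \<Rightarrow> (real \<Rightarrow> 'a) \<Rightarrow> bool" where
  "ivp_solution g t0 x0 x \<longleftrightarrow>
     x t0 = x0 \<and> (\<forall>t\<ge>t0. (x has_vector_derivative g t (x t)) (at t within {t0..}))"

text \<open>Uniqueness can only concern the values on \<open>{t0..}\<close>: an element of
  \<^typ>\<open>real \<Rightarrow> 'a\<close> is unconstrained before \<open>t0\<close>.\<close>

definition uniquely_solvable ::
  "(real \<Rightarrow> 'a \<Rightarrow> 'a::real_normed_vector) \<Rightarrow> real \<Rightarrow> 'a \<Rightarrow> bool" where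
  "uniquely_solvable g t0 x0 \<longleftrightarrow>
     (\<exists>x. ivp_solution g t0 x0 x) \<and>
     (\<forall>x y. ivp_solution g t0 x0 x \<longrightarrow> ivp_solution g t0 x0 y \<longrightarrow> (\<forall>t\<ge>t0. x t = y t))"

text \<open>Lyapunov's notions for the solution \<open>x = 0\<close> of \<open>x' = g t x\<close> with initial times in
  \<open>T\<close>. They are not uniform: \<open>\<delta>\<close> may depend on the initial time. The existence clauses
  keep the conditions on solutions from holding vacuously.\<close>

definition zero_stable ::
  "real set \<Rightarrow> (real \<Rightarrow> 'a \<Rightarrow> 'a::real_normed_vector) \<Rightarrow> bool" where
  "zero_stable T g \<longleftrightarrow>
     (\<forall>t0\<in>T. \<forall>\<epsilon>>0. \<exists>\<delta>>0. \<forall>x0. norm x0 < \<delta> \<longrightarrow>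
        (\<exists>x. ivp_solution g t0 x0 x) \<and>
        (\<forall>x. ivp_solution g t0 x0 x \<longrightarrow> (\<forall>t\<ge>t0. norm (x t) < \<epsilon>)))"

definition zero_attractive ::
  "real set \<Rightarrow> (real \<Rightarrow> 'a \<Rightarrow> 'a::real_normed_vector) \<Rightarrow> bool" where
  "zero_attractive T g \<longleftrightarrow>
     (\<forall>t0\<in>T. \<exists>\<delta>>0. \<forall>x0. norm x0 < \<delta> \<longrightarrow>
        (\<exists>x. ivp_solution g t0 x0 x) \<and>
        (\<forall>x. ivp_solution g t0 x0 x \<longrightarrow> (x \<longlongrightarrow> 0) at_top))"

definition zero_asymptotically_stable ::
  "real set \<Rightarrow> (real \<Rightarrow> 'a \<Rightarrow> 'a::real_normed_vector) \<Rightarrow> bool" where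
  "zero_asymptotically_stable T g \<longleftrightarrow> zero_stable T g \<and> zero_attractive T g"

text \<open>Taken in the extended reals, because the upper limit may be infinite.\<close>

definition decay_exponent ::
  "(real \<Rightarrow> real^'n^'n) \<Rightarrow> (real \<Rightarrow> real) \<Rightarrow> real \<Rightarrow> ereal" where
  "decay_exponent W l t0 =
     Limsup at_top (\<lambda>t. ereal (inverse (t - t0) *
       (integral {t0..t} (\<lambda>s. cond_number (W s) * l s) + ln (spectral_norm (W t)))))"

end

theory Submission
  imports Defs
begin

text \<open>
  Fix the initial time \<open>t0\<close>. In the moving coordinates \<open>y(t) = W(t)\<inverse> x(t)\<close> the linear part of the
  equation disappears: \<open>y' = W\<inverse> f(t, x)\<close> (\<open>has_vector_derivative_matrix_inv_mult\<close>). As long as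
  \<open>x\<close> stays where \<open>\<parallel>f(t, x)\<parallel> \<le> l(t) \<parallel>x\<parallel>\<close> holds, this gives
  \<open>\<parallel>y'\<parallel> \<le> \<parallel>W\<inverse>\<parallel> l \<parallel>W y\<parallel> \<le> k l \<parallel>y\<parallel>\<close>, where \<open>k = \<parallel>W\<parallel> \<parallel>W\<inverse>\<parallel>\<close> is the condition number.
  The differential form of Gronwall's inequality (\<open>norm_le_exp_integral\<close>) then bounds \<open>y\<close>, and
  multiplication by \<open>W\<close> turns the bound into
  \<open>\<parallel>x(t)\<parallel> \<le> E(t) \<parallel>W(t0)\<inverse>\<parallel> \<parallel>x(t0)\<parallel>\<close> with \<open>E(t) = exp (\<integral> k l) \<parallel>W(t)\<parallel>\<close>, the integral being taken
  from \<open>t0\<close> to \<open>t\<close> (\<open>perturbed_solution_bound\<close>).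

  The exponent of the theorem is exactly the upper growth rate of \<open>ln E\<close>. When it is negative, \<open>E\<close>
  decays exponentially (\<open>decay_exponent_neg_imp_tendsto\<close>) and is therefore bounded. A solution
  that starts close enough to \<open>0\<close> never reaches the boundary of a prescribed ball on which the bound
  on \<open>f\<close> is available, because at the first time of contact the estimate is still valid and
  excludes the contact (\<open>small_solutions_trapped_and_decay\<close>). Hence the estimate holds for all
  times; boundedness of \<open>E\<close> yields stability, and its convergence to \<open>0\<close> yields attractivity.
\<close>

section \<open>The spectral norm and the inverse matrix\<close>

lemma matrix_inv_right_left:
  fixes M :: "real^'n^'n"
  assumes "invertible M"
  shows matrix_inv_mult_right: "M ** matrix_inv M = mat 1"
    and matrix_inv_mult_left: "matrix_inv M ** M = mat 1"
  using someI_ex[OF assms[unfolded invertible_def]] by (simp_all add: matrix_inv_def)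

lemma invertible_matrix_inv:
  fixes M :: "real^'n^'n"
  assumes "invertible M"
  shows "invertible (matrix_inv M)"
  unfolding invertible_def using matrix_inv_right_left[OF assms] by blast

lemma norm_matrix_vector_le_spectral_norm: "norm (M *v v) \<le> spectral_norm M * norm v"
  unfolding spectral_norm_def by (rule onorm) simp

lemma spectral_norm_nonneg: "0 \<le> spectral_norm M"
  unfolding spectral_norm_def by (rule onorm_pos_le) simp

lemma spectral_norm_pos:
  fixes M :: "real^'n^'n"
  assumes "invertible M"
  shows "0 < spectral_norm M"
proof -
  have "M *v (matrix_inv M *v 1) = 1"
    by (simp add: matrix_vector_mul_assoc matrix_inv_mult_right assms)
  then have "\<not> (\<forall>v. M *v v = 0)"
    by (metis zero_neq_one)
  then show ?thesis
    unfolding spectral_norm_def by (subst onorm_pos_lt) simp_all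
qed

text \<open>Being a norm on a finite-dimensional space, the spectral norm is convex, and convex
  functions are continuous there.\<close>

lemma continuous_on_spectral_norm:
  "continuous_on UNIV (spectral_norm :: real^'n^'m \<Rightarrow> real)"
proof (rule convex_on_continuous)
  show "convex_on UNIV (spectral_norm :: real^'n^'m \<Rightarrow> real)"
  proof (rule convex_onI)
    fix t :: real and M L :: "real^'n^'m"
    assume t: "0 < t" "t < 1"
    have "spectral_norm ((1 - t) *\<^sub>R M + t *\<^sub>R L)
        = onorm (\<lambda>v. (1 - t) *\<^sub>R (M *v v) + t *\<^sub>R (L *v v))"
      by (simp add: spectral_norm_def matrix_vector_mult_add_rdistrib scaleR_matrix_vector_assoc)
    also have "\<dots> \<le> onorm (\<lambda>v. (1 - t) *\<^sub>R (M *v v)) + onorm (\<lambda>v. t *\<^sub>R (L *v v))"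
      by (intro onorm_triangle bounded_linear_intros) simp_all
    also have "\<dots> = (1 - t) * spectral_norm M + t * spectral_norm L"
      using t by (simp add: onorm_scaleR spectral_norm_def)
    finally show "spectral_norm ((1 - t) *\<^sub>R M + t *\<^sub>R L)
        \<le> (1 - t) * spectral_norm M + t * spectral_norm L" .
  qed simp
qed simp

text \<open>Cramer's rule for the columns of the inverse shows that its entries are rational functions
  of the entries of the matrix; this is where continuity of inversion comes from.\<close>

lemma matrix_inv_Cramer:
  fixes M :: "real^'n^'n"
  assumes "invertible M"
  shows "matrix_inv M = (\<chi> k j. det (\<chi> i m. if m = k then axis j 1 $ i else M $ i $ m) / det M)"
proof -
  have "M *v column j (matrix_inv M) = axis j 1" for j
    by (metis assms matrix_inv_mult_right matrix_vector_mul_assoc matrix_vector_mul_lid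
        matrix_vector_mult_basis)
  then have "column j (matrix_inv M)
      = (\<chi> k. det (\<chi> i m. if m = k then axis j 1 $ i else M $ i $ m) / det M)" for j
    by (rule cramer[THEN iffD1, OF assms[unfolded invertible_det_nz]])
  then have "matrix_inv M $ k $ j
      = det (\<chi> i m. if m = k then axis j 1 $ i else M $ i $ m) / det M" for k j
    by (metis (no_types, lifting) column_def vec_lambda_beta)
  then show ?thesis by (simp add: vec_eq_iff)
qed

lemma tendsto_det:
  fixes M :: "'a \<Rightarrow> real^'n^'n"
  assumes "(M \<longlongrightarrow> L) F"
  shows "((\<lambda>t. det (M t)) \<longlongrightarrow> det L) F"
  unfolding det_def by (intro tendsto_intros assms)

lemma tendsto_matrix_inv:
  fixes M :: "'a \<Rightarrow> real^'n^'n"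
  assumes M: "(M \<longlongrightarrow> L) F" and L: "invertible L"
  shows "((\<lambda>t. matrix_inv (M t)) \<longlongrightarrow> matrix_inv L) F"
proof -
  define adj where "adj = (\<lambda>(M :: real^'n^'n) k j.
    det (\<chi> i m. if m = k then axis j 1 $ i else M $ i $ m))"
  have "det L \<noteq> 0" using L by (simp add: invertible_det_nz)
  have "((\<lambda>t. if m = k then axis j 1 $ i else M t $ i $ m)
      \<longlongrightarrow> (if m = k then axis j 1 $ i else L $ i $ m)) F" for i j k m
    using tendsto_vec_nth[OF tendsto_vec_nth[OF M]] by (cases "m = k") simp_all
  then have "((\<lambda>t. adj (M t) k j) \<longlongrightarrow> adj L k j) F" for k j
    unfolding adj_def by (intro tendsto_det tendsto_vec_lambda)
  then have "((\<lambda>t. \<chi> k j. adj (M t) k j / det (M t)) \<longlongrightarrow> (\<chi> k j. adj L k j / det L)) F"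
    by (intro tendsto_vec_lambda tendsto_divide tendsto_det M \<open>det L \<noteq> 0\<close>)
  moreover have "eventually (\<lambda>t. det (M t) \<noteq> 0) F"
    using tendsto_imp_eventually_ne[OF tendsto_det[OF M] \<open>det L \<noteq> 0\<close>] .
  then have "eventually (\<lambda>t. (\<chi> k j. adj (M t) k j / det (M t)) = matrix_inv (M t)) F"
    by eventually_elim (simp add: adj_def matrix_inv_Cramer invertible_det_nz)
  ultimately show ?thesis
    using L by (auto simp: adj_def matrix_inv_Cramer intro: Lim_transform_eventually)
qed

lemma bounded_bilinear_matrix_vector_mult:
  "bounded_bilinear ((*v) :: real^'n^'m \<Rightarrow> real^'n \<Rightarrow> real^'m)"
  unfolding bilinear_conv_bounded_bilinear[symmetric] bilinear_def
  by (auto intro!: linearI simp: matrix_vector_mult_add_rdistrib matrix_vector_right_distrib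
      scaleR_matrix_vector_assoc matrix_vector_mult_scaleR)

section \<open>Differentiation in moving coordinates\<close>

text \<open>The difference quotient, rather than the remainder of the linear approximation, is the form
  in which a limit of a product can be taken.\<close>

lemma has_vector_derivative_iff_tendsto:
  "(f has_vector_derivative D) (at s within S)
    \<longleftrightarrow> ((\<lambda>t. (f t - f s) /\<^sub>R (t - s)) \<longlongrightarrow> D) (at s within S)"
proof -
  have "norm ((1 / norm (t - s)) *\<^sub>R (f t - (f s + (t - s) *\<^sub>R D)))
      = norm ((f t - f s) /\<^sub>R (t - s) - D)" if "t \<noteq> s" for t
  proof -
    have "(f t - f s) /\<^sub>R (t - s) - D = (1 / (t - s)) *\<^sub>R (f t - (f s + (t - s) *\<^sub>R D))"
      using that by (simp add: diff_diff_eq[symmetric] scaleR_right_diff_distrib inverse_eq_divide)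
    then show ?thesis by simp
  qed
  then have ev: "eventually (\<lambda>t. norm ((1 / norm (t - s)) *\<^sub>R (f t - (f s + (t - s) *\<^sub>R D)))
      = norm ((f t - f s) /\<^sub>R (t - s) - D)) (at s within S)"
    by (auto simp: eventually_at_filter)
  have "((\<lambda>t. (1 / norm (t - s)) *\<^sub>R (f t - (f s + (t - s) *\<^sub>R D))) \<longlongrightarrow> 0) (at s within S)
      \<longleftrightarrow> ((\<lambda>t. (f t - f s) /\<^sub>R (t - s) - D) \<longlongrightarrow> 0) (at s within S)"
    using tendsto_cong[OF ev, of 0] by (simp only: tendsto_norm_zero_iff)
  then show ?thesis
    unfolding has_vector_derivative_def has_derivative_within
    by (simp add: bounded_linear_scaleR_left LIM_zero_iff)
qed

text \<open>The derivative of the inverse matrix is avoided by freezing \<open>y(s)\<close>: since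
  \<open>y(t) - y(s) = W(t)\<inverse> (x(t) - W(t) y(s))\<close>, where the bracket vanishes at \<open>s\<close> and is
  differentiable, continuity of inversion suffices to pass to the limit in the difference
  quotient.\<close>

lemma has_vector_derivative_matrix_inv_mult:
  fixes W :: "real \<Rightarrow> real^'n^'n"
  assumes W: "(W has_vector_derivative W') (at s within S)"
    and x: "(x has_vector_derivative x') (at s within S)"
    and inv: "\<And>t. t \<in> S \<Longrightarrow> invertible (W t)" and s: "s \<in> S"
  shows "((\<lambda>t. matrix_inv (W t) *v x t) has_vector_derivative
    matrix_inv (W s) *v (x' - W' *v (matrix_inv (W s) *v x s))) (at s within S)"
proof -
  define v where "v = matrix_inv (W s) *v x s"
  define z where "z = (\<lambda>t. x t - W t *v v)"
  have "z s = 0"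
    by (simp add: z_def v_def matrix_vector_mul_assoc matrix_inv_mult_right inv s)
  have "((\<lambda>t. W t *v v) has_vector_derivative W' *v v) (at s within S)"
    using bounded_linear.has_vector_derivative[OF
        bounded_bilinear.bounded_linear_left[OF bounded_bilinear_matrix_vector_mult] W] .
  then have "(z has_vector_derivative x' - W' *v v) (at s within S)"
    unfolding z_def by (intro has_vector_derivative_diff x)
  then have "((\<lambda>t. (z t - z s) /\<^sub>R (t - s)) \<longlongrightarrow> x' - W' *v v) (at s within S)"
    by (simp add: has_vector_derivative_iff_tendsto)
  moreover have "(W \<longlongrightarrow> W s) (at s within S)"
    using has_vector_derivative_continuous[OF W] by (simp add: continuous_within)
  then have "((\<lambda>t. matrix_inv (W t)) \<longlongrightarrow> matrix_inv (W s)) (at s within S)"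
    by (rule tendsto_matrix_inv) (rule inv[OF s])
  ultimately have lim: "((\<lambda>t. matrix_inv (W t) *v ((z t - z s) /\<^sub>R (t - s)))
      \<longlongrightarrow> matrix_inv (W s) *v (x' - W' *v v)) (at s within S)"
    by (intro bounded_bilinear.tendsto[OF bounded_bilinear_matrix_vector_mult])
  have "matrix_inv (W t) *v ((z t - z s) /\<^sub>R (t - s)) = (matrix_inv (W t) *v x t - v) /\<^sub>R (t - s)"
    if "t \<in> S" for t
  proof -
    have "matrix_inv (W t) *v z t = matrix_inv (W t) *v x t - v"
      using that by (simp add: z_def matrix_vector_mult_diff_distrib matrix_vector_mul_assoc
          matrix_inv_mult_left inv)
    then show ?thesis
      by (simp add: \<open>z s = 0\<close> matrix_vector_mult_scaleR)
  qed
  then have "eventually (\<lambda>t. matrix_inv (W t) *v ((z t - z s) /\<^sub>R (t - s))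
      = (matrix_inv (W t) *v x t - v) /\<^sub>R (t - s)) (at s within S)"
    by (auto simp: eventually_at_filter)
  from Lim_transform_eventually[OF lim this] show ?thesis
    by (simp add: has_vector_derivative_iff_tendsto v_def)
qed

section \<open>Growth of solutions of the perturbed equation\<close>

text \<open>Gronwall's inequality in differential form: \<open>\<parallel>y\<parallel>\<^sup>2 exp (-2 \<integral> a)\<close> is nonincreasing. Squaring
  the norm makes it differentiable also where \<open>y\<close> vanishes.\<close>

lemma norm_le_exp_integral:
  fixes y :: "real \<Rightarrow> 'a::real_inner"
  assumes le: "t0 \<le> t1"
    and a: "continuous_on {t0..t1} a"
    and y: "continuous_on {t0..t1} y"
    and growth: "\<And>t. t0 < t \<Longrightarrow> t < t1 \<Longrightarrow>
      \<exists>y'. (y has_vector_derivative y') (at t) \<and> norm y' \<le> a t * norm (y t)"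
  shows "norm (y t1) \<le> norm (y t0) * exp (integral {t0..t1} a)"
proof -
  define I where "I = (\<lambda>t. integral {t0..t} a)"
  define g where "g = (\<lambda>t. (norm (y t))\<^sup>2 * exp (- 2 * I t))"
  have "g t1 \<le> g t0"
  proof (rule DERIV_nonpos_imp_decreasing_open[OF le])
    fix t assume t: "t0 < t" "t < t1"
    obtain y' where y': "(y has_vector_derivative y') (at t)" "norm y' \<le> a t * norm (y t)"
      using growth t by blast
    have "(I has_real_derivative a t) (at t within {t0..t1})"
      unfolding I_def using integral_has_real_derivative[OF a] t by simp
    then have I': "(I has_real_derivative a t) (at t)"
      using t at_within_Icc_at[of t0 t t1] by simp
    have "((\<lambda>s. y s \<bullet> y s) has_real_derivative 2 * (y t \<bullet> y')) (at t)"
      using bounded_bilinear.has_vector_derivative[OF bounded_bilinear_inner y'(1) y'(1)]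
      by (simp add: has_real_derivative_iff_has_vector_derivative inner_commute)
    then have "(g has_real_derivative
        2 * (y t \<bullet> y') * exp (- 2 * I t) + (y t \<bullet> y t) * (exp (- 2 * I t) * (- 2 * a t))) (at t)"
      unfolding g_def power2_norm_eq_inner by (auto intro!: derivative_eq_intros I')
    moreover have "y t \<bullet> y' \<le> a t * (y t \<bullet> y t)"
    proof -
      have "y t \<bullet> y' \<le> norm (y t) * norm y'" by (rule norm_cauchy_schwarz)
      also have "\<dots> \<le> norm (y t) * (a t * norm (y t))" by (intro mult_left_mono y') simp
      finally show ?thesis by (simp add: power2_norm_eq_inner[symmetric] power2_eq_square ac_simps)
    qed
    then have "(2 * exp (- 2 * I t)) * (y t \<bullet> y' - a t * (y t \<bullet> y t)) \<le> 0"
      by (intro mult_nonneg_nonpos) auto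
    ultimately show "\<exists>d. (g has_real_derivative d) (at t) \<and> d \<le> 0"
      by (intro exI conjI) (auto simp: algebra_simps)
  next
    show "continuous_on {t0..t1} g"
      unfolding g_def I_def
      by (intro continuous_intros y indefinite_integral_continuous_1 integrable_continuous_real a)
  qed
  then have "(norm (y t1))\<^sup>2 \<le> (norm (y t0))\<^sup>2 * exp (2 * I t1)"
    by (simp add: g_def I_def exp_minus field_simps)
  also have "\<dots> = (norm (y t0) * exp (I t1))\<^sup>2"
    by (simp add: power_mult_distrib exp_double)
  finally show ?thesis
    unfolding I_def by (rule power2_le_imp_le) simp
qed

lemma continuous_on_cond_number:
  fixes W :: "real \<Rightarrow> real^'n^'n"
  assumes W: "continuous_on S W" and inv: "\<And>t. t \<in> S \<Longrightarrow> invertible (W t)"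
  shows "continuous_on S (\<lambda>t. cond_number (W t))"
proof -
  have "continuous_on S (\<lambda>t. matrix_inv (W t))"
    using W inv by (auto simp: continuous_on_def intro: tendsto_matrix_inv)
  then show ?thesis
    unfolding cond_number_def
    by (intro continuous_intros continuous_on_compose2[OF continuous_on_spectral_norm] W) auto
qed

lemma fundamental_matrix_continuous_on:
  assumes "fundamental_matrix A t0 W"
  shows "continuous_on {t0..} W"
  using assms unfolding fundamental_matrix_def continuous_on_eq_continuous_within
  by (auto intro: has_vector_derivative_continuous)

lemma ivp_solution_continuous_on:
  assumes "ivp_solution g t0 x0 x"
  shows "continuous_on {t0..} x"
  using assms unfolding ivp_solution_def continuous_on_eq_continuous_within
  by (auto intro: has_vector_derivative_continuous)

text \<open>The growth bound \<open>\<parallel>f(t, x)\<parallel> \<le> l(t) \<parallel>x\<parallel>\<close> is assumed strictly before \<open>t1\<close> only, so that the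
  conclusion is still available at the first time at which a solution touches the boundary of
  the region where the bound is known.\<close>

lemma perturbed_solution_bound:
  fixes A W :: "real \<Rightarrow> real^'n^'n"
  assumes W: "fundamental_matrix A t0 W"
    and x: "ivp_solution (\<lambda>t x. A t *v x + f t x) t0 x0 x"
    and le: "t0 \<le> t1"
    and l: "continuous_on {t0..} l" "\<And>t. t0 \<le> t \<Longrightarrow> 0 \<le> l t"
    and f: "\<And>t. t0 < t \<Longrightarrow> t < t1 \<Longrightarrow> norm (f t (x t)) \<le> l t * norm (x t)"
  shows "norm (x t1) \<le> exp (integral {t0..t1} (\<lambda>s. cond_number (W s) * l s)) * spectral_norm (W t1)
    * (spectral_norm (matrix_inv (W t0)) * norm x0)"
proof -
  define k where "k = (\<lambda>s. cond_number (W s) * l s)"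
  define y where "y = (\<lambda>t. matrix_inv (W t) *v x t)"
  have W': "(W has_vector_derivative A t ** W t) (at t within {t0..})"
    and inv: "invertible (W t)" if "t0 \<le> t" for t
    using W that by (auto simp: fundamental_matrix_def)
  have Wy: "W t *v y t = x t" if "t0 \<le> t" for t
    using inv[OF that] by (simp add: y_def matrix_vector_mul_assoc matrix_inv_mult_right)
  have y': "(y has_vector_derivative matrix_inv (W t) *v f t (x t)) (at t within {t0..})"
    if t: "t0 \<le> t" for t
  proof -
    have "(x has_vector_derivative A t *v x t + f t (x t)) (at t within {t0..})"
      using x t by (simp add: ivp_solution_def)
    from has_vector_derivative_matrix_inv_mult[OF W'[OF t] this] inv t
    have "(y has_vector_derivative matrix_inv (W t) *v
        (A t *v x t + f t (x t) - (A t ** W t) *v y t)) (at t within {t0..})"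
      by (simp add: y_def)
    then show ?thesis
      using Wy[OF t] by (simp add: matrix_vector_mul_assoc[symmetric])
  qed
  have "norm (y t1) \<le> norm (y t0) * exp (integral {t0..t1} k)"
  proof (rule norm_le_exp_integral[OF le])
    show "continuous_on {t0..t1} k"
      unfolding k_def
      by (intro continuous_intros continuous_on_cond_number
          continuous_on_subset[OF fundamental_matrix_continuous_on[OF W]]
          continuous_on_subset[OF l(1)] inv) auto
    have "continuous_on {t0..} y"
      unfolding continuous_on_eq_continuous_within
      using y' has_vector_derivative_continuous by fastforce
    then show "continuous_on {t0..t1} y"
      by (rule continuous_on_subset) auto
  next
    fix t assume t: "t0 < t" "t < t1"
    have "at t within {t0..} = at t"
      using t by (intro at_within_interior) simp
    with y'[of t] t have "(y has_vector_derivative matrix_inv (W t) *v f t (x t)) (at t)"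
      by simp
    moreover have "norm (matrix_inv (W t) *v f t (x t)) \<le> k t * norm (y t)"
    proof -
      have "norm (matrix_inv (W t) *v f t (x t)) \<le> spectral_norm (matrix_inv (W t)) * norm (f t (x t))"
        by (rule norm_matrix_vector_le_spectral_norm)
      also have "\<dots> \<le> spectral_norm (matrix_inv (W t)) * (l t * norm (x t))"
        using t by (intro mult_left_mono f spectral_norm_nonneg) auto
      also have "\<dots> \<le> spectral_norm (matrix_inv (W t)) * (l t * (spectral_norm (W t) * norm (y t)))"
        using t norm_matrix_vector_le_spectral_norm[of "W t" "y t"]
        by (intro mult_left_mono spectral_norm_nonneg l) (auto simp: Wy)
      finally show ?thesis by (simp add: k_def cond_number_def ac_simps)
    qed
    ultimately show "\<exists>d. (y has_vector_derivative d) (at t) \<and> norm d \<le> k t * norm (y t)"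
      by blast
  qed
  also have "\<dots> \<le> spectral_norm (matrix_inv (W t0)) * norm x0 * exp (integral {t0..t1} k)"
    using norm_matrix_vector_le_spectral_norm[of "matrix_inv (W t0)" x0] x
    by (intro mult_right_mono) (auto simp: y_def ivp_solution_def)
  finally have "spectral_norm (W t1) * norm (y t1)
      \<le> spectral_norm (W t1) * (spectral_norm (matrix_inv (W t0)) * norm x0 * exp (integral {t0..t1} k))"
    by (intro mult_left_mono spectral_norm_nonneg)
  moreover have "norm (x t1) \<le> spectral_norm (W t1) * norm (y t1)"
    using norm_matrix_vector_le_spectral_norm[of "W t1" "y t1"] Wy[OF le] by simp
  ultimately show ?thesis by (simp add: k_def ac_simps)
qed

section \<open>Decay of the amplification factor\<close>

text \<open>With \<open>E\<close> the function whose limit is taken, a negative upper growth rate of \<open>ln E\<close> leaves room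
  for some \<open>z < 0\<close> with \<open>E(t) \<le> exp (z (t - t0))\<close> eventually.\<close>

lemma decay_exponent_neg_imp_tendsto:
  fixes W :: "real \<Rightarrow> real^'n^'n"
  assumes inv: "\<And>t. t0 \<le> t \<Longrightarrow> invertible (W t)" and neg: "decay_exponent W l t0 < 0"
  shows "((\<lambda>t. exp (integral {t0..t} (\<lambda>s. cond_number (W s) * l s)) * spectral_norm (W t))
    \<longlongrightarrow> 0) at_top"
proof -
  define L where "L = (\<lambda>t. integral {t0..t} (\<lambda>s. cond_number (W s) * l s) + ln (spectral_norm (W t)))"
  obtain z where z: "decay_exponent W l t0 < ereal z" "ereal z < 0"
    using ereal_dense2[OF neg] by blast
  from Limsup_lessD[OF z(1)[unfolded decay_exponent_def]]
  have "eventually (\<lambda>t. inverse (t - t0) * L t < z) at_top"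
    by (simp add: L_def)
  with eventually_gt_at_top[of t0]
  have upper: "eventually (\<lambda>t. exp (integral {t0..t} (\<lambda>s. cond_number (W s) * l s)) * spectral_norm (W t)
      \<le> exp (z * (t - t0))) at_top"
  proof eventually_elim
    case (elim t)
    then have "L t \<le> z * (t - t0)" by (simp add: field_simps)
    moreover have "exp (L t)
        = exp (integral {t0..t} (\<lambda>s. cond_number (W s) * l s)) * spectral_norm (W t)"
      using elim spectral_norm_pos[OF inv[of t]] by (simp add: L_def exp_add)
    ultimately show ?case by (metis exp_le_cancel_iff)
  qed
  have "filterlim (\<lambda>t. - t0 + t) at_top at_top"
    by (rule filterlim_tendsto_add_at_top[OF tendsto_const filterlim_ident])
  then have "filterlim (\<lambda>t. z * (t - t0)) at_bot at_top"
    using filterlim_tendsto_neg_mult_at_bot[OF tendsto_const, of z "\<lambda>t. - t0 + t"] z(2) by simp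
  then have lim: "((\<lambda>t. exp (z * (t - t0))) \<longlongrightarrow> 0) at_top"
    by (rule filterlim_compose[OF exp_at_bot])
  show ?thesis
    by (rule tendsto_sandwich[OF always_eventually upper tendsto_const lim])
      (simp add: spectral_norm_nonneg)
qed

lemma bounded_above_of_tendsto_at_top:
  fixes E :: "real \<Rightarrow> real"
  assumes cont: "continuous_on {t0..} E" and lim: "(E \<longlongrightarrow> c) at_top"
  shows "\<exists>B>0. \<forall>t\<ge>t0. E t \<le> B"
proof -
  have "eventually (\<lambda>t. E t < c + 1) at_top"
    using lim by (rule order_tendstoD) simp
  then obtain S where S: "\<And>t. S \<le> t \<Longrightarrow> E t < c + 1"
    by (auto simp: eventually_at_top_linorder)
  have "compact (E ` {t0..S})"
    by (intro compact_continuous_image continuous_on_subset[OF cont]) auto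
  then obtain b where b: "\<And>t. t \<in> {t0..S} \<Longrightarrow> norm (E t) \<le> b"
    by (meson bounded_iff compact_imp_bounded image_eqI)
  have "E t \<le> max 1 (max b (c + 1))" if "t0 \<le> t" for t
    using that S[of t] b[of t] by (cases "S \<le> t") auto
  then show ?thesis by (intro exI[of _ "max 1 (max b (c + 1))"]) auto
qed

section \<open>Asymptotic stability\<close>

text \<open>Both halves of asymptotic stability come from the same confinement to a ball of radius \<open>r\<close>:
  the growth bound on \<open>f\<close> is known only inside that ball, so the decay estimate can be extended to
  all times only after the solution is known not to leave it.\<close>

lemma small_solutions_trapped_and_decay:
  fixes A W :: "real \<Rightarrow> real^'n^'n"
  assumes W: "fundamental_matrix A t0 W"
    and l: "continuous_on {t0..} l" "\<And>t. t0 \<le> t \<Longrightarrow> 0 \<le> l t"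
    and neg: "decay_exponent W l t0 < 0"
    and r: "0 < r"
    and f: "\<And>t x. t0 \<le> t \<Longrightarrow> norm x < r \<Longrightarrow> norm (f t x) \<le> l t * norm x"
  shows "\<exists>\<delta>>0. \<forall>x0 x. norm x0 < \<delta> \<longrightarrow> ivp_solution (\<lambda>t x. A t *v x + f t x) t0 x0 x \<longrightarrow>
    (\<forall>t\<ge>t0. norm (x t) < r) \<and> (x \<longlongrightarrow> 0) at_top"
proof -
  define k where "k = (\<lambda>s. cond_number (W s) * l s)"
  define E where "E = (\<lambda>t. exp (integral {t0..t} k) * spectral_norm (W t))"
  define C where "C = spectral_norm (matrix_inv (W t0))"
  have inv: "invertible (W t)" if "t0 \<le> t" for t
    using W that by (simp add: fundamental_matrix_def)
  have E_lim: "(E \<longlongrightarrow> 0) at_top"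
    unfolding E_def k_def by (rule decay_exponent_neg_imp_tendsto[OF inv neg])
  have W_cont: "continuous_on {t0..} W"
    by (rule fundamental_matrix_continuous_on[OF W])
  have k_cont: "continuous_on {t0..} k"
    unfolding k_def by (intro continuous_intros continuous_on_cond_number W_cont l inv) auto
  have "continuous_on {t0..} (\<lambda>t. integral {t0..t} k)"
    unfolding continuous_on_eq_continuous_within
  proof
    fix t assume t: "t \<in> {t0..}"
    have "continuous_on {t0..t + 1} (\<lambda>t. integral {t0..t} k)"
      by (intro indefinite_integral_continuous_1 integrable_continuous_real
          continuous_on_subset[OF k_cont]) auto
    then have "continuous (at t within {t0..t + 1}) (\<lambda>t. integral {t0..t} k)"
      using t by (simp add: continuous_on_eq_continuous_within)
    moreover have "at t within {t0..t + 1} = at t within {t0..}"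
      by (rule at_within_nhd[of _ "{..<t + 1}"]) auto
    ultimately show "continuous (at t within {t0..}) (\<lambda>t. integral {t0..t} k)" by simp
  qed
  then have "continuous_on {t0..} E"
    unfolding E_def
    by (intro continuous_intros continuous_on_compose2[OF continuous_on_spectral_norm] W_cont) auto
  then obtain B where B: "0 < B" "\<And>t. t0 \<le> t \<Longrightarrow> E t \<le> B"
    using bounded_above_of_tendsto_at_top[OF _ E_lim] by blast
  have "0 < C"
    unfolding C_def by (intro spectral_norm_pos invertible_matrix_inv inv) simp
  show ?thesis
  proof (intro exI conjI allI impI)
    \<comment> \<open>\<open>B\<close> bounds \<open>E\<close>, hence \<open>\<parallel>x(t)\<parallel> \<le> E(t) C \<parallel>x0\<parallel>\<close> stays below \<open>r\<close> for this radius\<close>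
    show "0 < r / (B * C)" using r B \<open>0 < C\<close> by simp
    fix x0 x
    assume x0: "norm x0 < r / (B * C)"
      and x: "ivp_solution (\<lambda>t x. A t *v x + f t x) t0 x0 x"
    have estimate: "norm (x t) \<le> E t * (C * norm x0)"
      if "t0 \<le> t" "\<And>s. t0 < s \<Longrightarrow> s < t \<Longrightarrow> norm (x s) < r" for t
      unfolding E_def C_def k_def
      using that by (intro perturbed_solution_bound[OF W x _ l] f) auto
    have small: "E t * (C * norm x0) < r" if "t0 \<le> t" for t
    proof -
      have "E t * (C * norm x0) \<le> B * (C * norm x0)"
        using B(2)[OF that] \<open>0 < C\<close> by (intro mult_right_mono) auto
      also have "\<dots> < r"
        using x0 B \<open>0 < C\<close> by (simp add: field_simps)
      finally show ?thesis .
    qed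
    show inside: "norm (x t) < r" if "t0 \<le> t" for t
    proof (rule ccontr)
      assume "\<not> norm (x t) < r"
      \<comment> \<open>The least element of \<open>K\<close> is the first time of contact with the sphere of radius \<open>r\<close>.\<close>
      define K where "K = {t0..t} \<inter> (\<lambda>s. norm (x s)) -` {r..}"
      have "continuous_on {t0..t} (\<lambda>s. norm (x s))"
        by (intro continuous_intros continuous_on_subset[OF ivp_solution_continuous_on[OF x]]) auto
      then have "closed K"
        unfolding K_def by (intro continuous_closed_preimage) auto
      then have "compact K"
        unfolding K_def by (metis Int_lower1 bounded_closed_interval bounded_subset compact_eq_bounded_closed)
      moreover have "t \<in> K"
        using that \<open>\<not> norm (x t) < r\<close> by (simp add: K_def)
      ultimately obtain t1 where t1: "t1 \<in> K" "\<And>s. s \<in> K \<Longrightarrow> t1 \<le> s"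
        using compact_attains_inf[of K] by blast
      have "norm (x s) < r" if "t0 < s" "s < t1" for s
        using t1(1) t1(2)[of s] that by (force simp: K_def)
      then have "norm (x t1) < r"
        using estimate[of t1] small[of t1] t1(1) by (force simp: K_def)
      then show False using t1(1) by (simp add: K_def)
    qed
    have "((\<lambda>t. E t * (C * norm x0)) \<longlongrightarrow> 0) at_top"
      using tendsto_mult_right[OF E_lim, of "C * norm x0"] by simp
    moreover have "eventually (\<lambda>t. norm (x t) \<le> E t * (C * norm x0)) at_top"
      using eventually_ge_at_top[of t0] by eventually_elim (intro estimate inside; simp)
    ultimately show "(x \<longlongrightarrow> 0) at_top"
      by (rule Lim_null_comparison[rotated])
  qed
qed

theorem corollary3:
  fixes \<tau> lhat :: real
    and T :: "real set"
    and A :: "real \<Rightarrow> real^'n^'n"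
    and f :: "real \<Rightarrow> real^'n \<Rightarrow> real^'n"
    and W :: "real \<Rightarrow> real \<Rightarrow> real^'n^'n"
    and l :: "real \<Rightarrow> real"
    and N \<Omega>1 :: "(real^'n) set"
  assumes T: "T = {\<tau>..}"
    and A_cont: "continuous_on T A"
    and f_cont: "continuous_on (T \<times> UNIV) (\<lambda>(t, x). f t x)"
    and f_zero: "\<And>t. t \<in> T \<Longrightarrow> f t 0 = 0"
    and N_nhd: "0 \<in> interior N"
    and solvable: "\<And>t0 x0. t0 \<in> T \<Longrightarrow> x0 \<in> N \<Longrightarrow>
      uniquely_solvable (\<lambda>t x. A t *v x + f t x) t0 x0"
    and W_fundamental: "\<And>t0. t0 \<in> T \<Longrightarrow> fundamental_matrix A t0 (W t0)"
    and W_normalized: "\<And>t0. t0 \<in> T \<Longrightarrow> spectral_norm (W t0 t0) = 1"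
    and \<Omega>1_nhd: "0 \<in> interior \<Omega>1"
    and \<Omega>1_bounded: "bounded \<Omega>1"
    and l_cont: "continuous_on T l"
    and l_bounds: "\<And>t. t \<in> T \<Longrightarrow> 0 < l t \<and> l t \<le> lhat"
    and simple: "\<And>t0 t. t0 \<in> T \<Longrightarrow> t0 \<le> t \<Longrightarrow> simple_largest_singular_value (W t0 t)"
    and f_bound: "\<And>t0 t x. t0 \<in> T \<Longrightarrow> t0 \<le> t \<Longrightarrow> x \<in> \<Omega>1 \<Longrightarrow> norm (f t x) \<le> l t * norm x"
    and exponent_neg: "\<And>t0. t0 \<in> T \<Longrightarrow> decay_exponent (W t0) l t0 < 0"
  shows "zero_asymptotically_stable T (\<lambda>t x. A t *v x + f t x)"
proof -
  obtain \<eta> where \<eta>: "0 < \<eta>" "ball 0 \<eta> \<subseteq> N"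
    using N_nhd mem_interior by blast
  obtain \<rho> where \<rho>: "0 < \<rho>" "ball 0 \<rho> \<subseteq> \<Omega>1"
    using \<Omega>1_nhd mem_interior by blast
  have main: "\<exists>\<delta>>0. \<forall>x0. norm x0 < \<delta> \<longrightarrow>
      (\<exists>x. ivp_solution (\<lambda>t x. A t *v x + f t x) t0 x0 x) \<and>
      (\<forall>x. ivp_solution (\<lambda>t x. A t *v x + f t x) t0 x0 x \<longrightarrow>
        (\<forall>t\<ge>t0. norm (x t) < \<epsilon>) \<and> (x \<longlongrightarrow> 0) at_top)"
    if t0: "t0 \<in> T" and \<epsilon>: "0 < \<epsilon>" for t0 \<epsilon> :: real
  proof -
    have sub: "{t0..} \<subseteq> T" using t0 T by auto
    obtain \<delta> where \<delta>: "0 < \<delta>" "\<And>x0 x. norm x0 < \<delta> \<Longrightarrow>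
        ivp_solution (\<lambda>t x. A t *v x + f t x) t0 x0 x \<Longrightarrow>
        (\<forall>t\<ge>t0. norm (x t) < min \<epsilon> \<rho>) \<and> (x \<longlongrightarrow> 0) at_top"
    proof -
      have "\<exists>\<delta>>0. \<forall>x0 x. norm x0 < \<delta> \<longrightarrow> ivp_solution (\<lambda>t x. A t *v x + f t x) t0 x0 x \<longrightarrow>
          (\<forall>t\<ge>t0. norm (x t) < min \<epsilon> \<rho>) \<and> (x \<longlongrightarrow> 0) at_top"
      proof (rule small_solutions_trapped_and_decay[OF W_fundamental[OF t0] _ _ exponent_neg[OF t0]])
        show "continuous_on {t0..} l" using l_cont sub by (rule continuous_on_subset)
        show "0 \<le> l t" if "t0 \<le> t" for t
          using l_bounds[of t] sub that by force
        show "0 < min \<epsilon> \<rho>" using \<epsilon> \<rho> by simp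
        show "norm (f t x) \<le> l t * norm x" if "t0 \<le> t" "norm x < min \<epsilon> \<rho>" for t x
          using f_bound[OF t0 that(1), of x] \<rho>(2) that(2) by auto
      qed
      then show ?thesis using that by blast
    qed
    have "x0 \<in> N" if "norm x0 < \<eta>" for x0
      using \<eta>(2) that by auto
    then have ex: "\<exists>x. ivp_solution (\<lambda>t x. A t *v x + f t x) t0 x0 x" if "norm x0 < \<eta>" for x0
      using solvable[OF t0] that by (auto simp: uniquely_solvable_def)
    show ?thesis
    proof (intro exI[of _ "min \<delta> \<eta>"] conjI allI impI)
      show "0 < min \<delta> \<eta>" using \<delta>(1) \<eta>(1) by simp
    next
      fix x0 :: "real^'n" assume "norm x0 < min \<delta> \<eta>"
      then show "\<exists>x. ivp_solution (\<lambda>t x. A t *v x + f t x) t0 x0 x"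
        by (intro ex) simp
    next
      fix x0 x t
      assume "norm x0 < min \<delta> \<eta>" "ivp_solution (\<lambda>t x. A t *v x + f t x) t0 x0 x" "t0 \<le> t"
      then show "norm (x t) < \<epsilon>" using \<delta>(2)[of x0 x] by simp
    next
      fix x0 x
      assume "norm x0 < min \<delta> \<eta>" "ivp_solution (\<lambda>t x. A t *v x + f t x) t0 x0 x"
      then show "(x \<longlongrightarrow> 0) at_top" using \<delta>(2)[of x0 x] by simp
    qed
  qed
  show ?thesis
    unfolding zero_asymptotically_stable_def zero_stable_def zero_attractive_def
  proof (intro conjI ballI allI impI)
    fix t0 \<epsilon> :: real assume "t0 \<in> T" "0 < \<epsilon>"
    from main[OF this] show "\<exists>\<delta>>0. \<forall>x0. norm x0 < \<delta> \<longrightarrow>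
        (\<exists>x. ivp_solution (\<lambda>t x. A t *v x + f t x) t0 x0 x) \<and>
        (\<forall>x. ivp_solution (\<lambda>t x. A t *v x + f t x) t0 x0 x \<longrightarrow> (\<forall>t\<ge>t0. norm (x t) < \<epsilon>))"
      by meson
  next
    fix t0 assume "t0 \<in> T"
    from main[OF this zero_less_one] show "\<exists>\<delta>>0. \<forall>x0. norm x0 < \<delta> \<longrightarrow>
        (\<exists>x. ivp_solution (\<lambda>t x. A t *v x + f t x) t0 x0 x) \<and>
        (\<forall>x. ivp_solution (\<lambda>t x. A t *v x + f t x) t0 x0 x \<longrightarrow> (x \<longlongrightarrow> 0) at_top)"
      by meson
  qed
qed

end
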